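(* Let $\mathtt x>0$, $\mathtt r>0$, and let $\mathcal D^2$ be a symmetric positive definite $p^*\times p^*$ matrix. Assume that there is a constant $\delta(\mathtt r)$ such that $$\bigl\|\mathcal D^{-1}\{-\nabla^2E\mathcal L(\upsilon)\}\mathcal D^{-1}-I_{p^*}\bigr\|\le\delta(\mathtt r)\qquad\text{for all }\upsilon\in\Upsilon_\circ(\mathtt r).$$ If $\mathtt r\ge\mathfrak z(\mathtt x,B)$, then on the event $$\mathcal M(\mathtt x)=\bigl\{\tilde\upsilon,\ \tilde\upsilon_{\theta^*},\ \upsilon^*+\mathcal D^{-2}\nabla\mathcal L(\upsilon^* )\in\Upsilon_\circ(\mathtt r)\bigr\}\cap\bigl\{\|\mathcal D^{-1}\nabla\mathcal L(\upsilon^* )\|\le\mathfrak z(\mathtt x,B)\bigr\}\cap\Bigl\{\sup_{\upsilon\in\Upsilon_\circ(\mathtt r)}\|\mathcal Y(\upsilon)\|\le6\nu_0\,\omega\,\mathfrak z_0(\mathtt x,p^* )\,\mathtt r\Bigr\}$$ it holds that $$\|\mathcal D(\tilde\upsilon-\upsilon^* )-\xi\|\le\Diamond(\mathtt r,\mathtt x),\qquad \xi=\mathcal D^{-1}\nabla\mathcal L(\upsilon^* ).$$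
   Context: Setting. $\mathcal L(\upsilon)$, $\upsilon=(\theta,\eta)\in\Upsilon\subseteq\mathbb R^{p^*}$, $\theta\in\mathbb R^p$, $\eta\in\mathbb R^{m}$, $p^*=p+m$, is a (quasi) log-likelihood of random data, sufficiently smooth in $\upsilon$; $\Pi_0\upsilon=\theta$; $\zeta=\mathcal L-E\mathcal L$. $\upsilon^*=\operatorname{argmax}_\Upsilon E\mathcal L$, $\theta^*=\Pi_0\upsilon^*$, $\tilde\upsilon=\operatorname{argmax}_\Upsilon\mathcal L$, $\tilde\upsilon_{\theta^*}=\operatorname{argmax}_{\Pi_0\upsilon=\theta^*}\mathcal L$; maximizers are stationary: $\nabla\mathcal L(\tilde\upsilon)=0$ and $\nabla E\mathcal L(\upsilon^* )=0$. $\Upsilon_\circ(\mathtt r)=\{\upsilon\in\Upsilon:\|\mathcal D(\upsilon-\upsilon^* )\|\le\mathtt r\}$ (a convex neighbourhood of $\upsilon^*$; typically $\mathcal D^2=-\nabla^2E\mathcal L(\upsilon^* )$). Normalized stochastic gradient gap: $\mathcal Y(\upsilon)=\mathcal D^{-1}\{\nabla\zeta(\upsilon)-\nabla\zeta(\upsilon^* )\}$. $\nu_0,\omega,\mathfrak z_0(\mathtt x,p^* )>0$ are given constants (in the paper coming from exponential moment conditions on $\nabla\zeta$ and an entropy bound), and $\mathfrak z(\mathtt x,B)$ is a given positive number (an upper quantile of $\|\mathcal D^{-1}\nabla\mathcal L(\upsilon^* )\|$). The approximation error is $\Diamond(\mathtt r,\mathtt x)=\{\delta(\mathtt r)+6\nu_0\omega\mathfrak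 z_0(\mathtt x,p^* )\}\,\mathtt r$. *)

theory Defs
  imports "HOL-Probability.Probability"
begin

definition sym_pos_def :: "real^'n^'n \<Rightarrow> bool" where
  "sym_pos_def A \<longleftrightarrow> transpose A = A \<and> (\<forall>x. x \<noteq> 0 \<longrightarrow> 0 < x \<bullet> (A *v x))"

definition gradient :: "('a::real_inner \<Rightarrow> real) \<Rightarrow> 'a \<Rightarrow> 'a" where
  "gradient f x = (THE g. GDERIV f x :> g)"

definition hessian :: "(real^'n \<Rightarrow> real) \<Rightarrow> real^'n \<Rightarrow> real^'n^'n" where
  "hessian f x = jacobian (gradient f) (at x)"

text \<open>The full parameter is \<open>\<upsilon> = (\<theta>, \<eta>)\<close> in \<open>real ^ ('p + 'm)\<close>: the \<open>Inl\<close> coordinates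
  form the target \<open>\<theta>\<close>, the \<open>Inr\<close> coordinates the nuisance \<open>\<eta>\<close>.\<close>

definition target :: "real^('p::finite + 'm::finite) \<Rightarrow> real^'p" where
  "target \<upsilon> = (\<chi> i. \<upsilon> $ Inl i)"

text \<open>A random function is \<open>L :: 's \<Rightarrow> real^'n \<Rightarrow> real\<close>, with \<open>L s\<close> its realisation at the
  sample point \<open>s\<close>.\<close>

definition mean_fun :: "'s measure \<Rightarrow> ('s \<Rightarrow> real^'n \<Rightarrow> real) \<Rightarrow> real^'n \<Rightarrow> real" where
  "mean_fun M L \<upsilon> = (\<integral>s. L s \<upsilon> \<partial>M)"

definition stoch_part :: "'s measure \<Rightarrow> ('s \<Rightarrow> real^'n \<Rightarrow> real) \<Rightarrow> 's \<Rightarrow> real^'n \<Rightarrow> real" where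
  "stoch_part M L s \<upsilon> = L s \<upsilon> - mean_fun M L \<upsilon>"

definition local_set :: "(real^'n) set \<Rightarrow> real^'n^'n \<Rightarrow> real^'n \<Rightarrow> real \<Rightarrow> (real^'n) set" where
  "local_set \<Upsilon> D \<upsilon>s r = {\<upsilon> \<in> \<Upsilon>. norm (D *v (\<upsilon> - \<upsilon>s)) \<le> r}"

definition score :: "('s \<Rightarrow> real^'n \<Rightarrow> real) \<Rightarrow> real^'n^'n \<Rightarrow> real^'n \<Rightarrow> 's \<Rightarrow> real^'n" where
  "score L D \<upsilon>s s = matrix_inv D *v gradient (L s) \<upsilon>s"

definition gradient_gap ::
  "'s measure \<Rightarrow> ('s \<Rightarrow> real^'n \<Rightarrow> real) \<Rightarrow> real^'n^'n \<Rightarrow> real^'n \<Rightarrow> 's \<Rightarrow> real^'n \<Rightarrow> real^'n" where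
  "gradient_gap M L D \<upsilon>s s \<upsilon> =
     matrix_inv D *v (gradient (stoch_part M L s) \<upsilon> - gradient (stoch_part M L s) \<upsilon>s)"

definition approx_error ::
  "(real \<Rightarrow> real) \<Rightarrow> real \<Rightarrow> real \<Rightarrow> (real \<Rightarrow> nat \<Rightarrow> real) \<Rightarrow> nat \<Rightarrow> real \<Rightarrow> real \<Rightarrow> real" where
  "approx_error \<delta> \<nu>0 \<omega> z0 d r x = (\<delta> r + 6 * \<nu>0 * \<omega> * z0 x d) * r"

text \<open>Here \<open>D2\<close> is the matrix \<open>D ** D\<close>, \<open>zB\<close> bounds the score and \<open>b\<close> bounds the gradient gap.
  The supremum is taken in \<^typ>\<open>ereal\<close>, so that it is infinite when the gap is unbounded.\<close>

definition good_event ::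
  "'s measure \<Rightarrow> ('s \<Rightarrow> real^'n \<Rightarrow> real) \<Rightarrow> (real^'n) set \<Rightarrow> real^'n^'n \<Rightarrow> real^'n^'n \<Rightarrow> real^'n
     \<Rightarrow> ('s \<Rightarrow> real^'n) \<Rightarrow> ('s \<Rightarrow> real^'n) \<Rightarrow> real \<Rightarrow> real \<Rightarrow> real \<Rightarrow> 's set" where
  "good_event M L \<Upsilon> D2 D \<upsilon>s \<upsilon>t \<upsilon>t\<theta> r zB b =
     {s \<in> space M. {\<upsilon>t s, \<upsilon>t\<theta> s, \<upsilon>s + matrix_inv D2 *v gradient (L s) \<upsilon>s}
        \<subseteq> local_set \<Upsilon> D \<upsilon>s r}
   \<inter> {s \<in> space M. norm (score L D \<upsilon>s s) \<le> zB}
   \<inter> {s \<in> space M. (SUP \<upsilon> \<in> local_set \<Upsilon> D \<upsilon>s r. ereal (norm (gradient_gap M L D \<upsilon>s s \<upsilon>))) \<le> ereal b}"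

end

(* Read in the coordinates u = D \<upsilon>, the map u \<mapsto> D^-1 \<nabla>EL(D^-1 u) + u has derivative
   I - D^-1 (-\<nabla>^2 EL) D^-1, of norm at most \<delta>(r), so it moves by at most \<delta>(r) r between \<upsilon>* and
   any point of the convex local set. At the maximizer, stationarity turns the stochastic gradient
   gap into -D^-1 \<nabla>EL - \<xi>, so that the residual D \<upsilon> - D \<upsilon>* - \<xi> is the sum of the two. *)
theory Submission
  imports Defs
begin

lemma gradient_eqI:
  assumes "GDERIV f x :> g"
  shows "gradient f x = g"
  unfolding gradient_def
proof (rule the_equality)
  fix g' assume "GDERIV f x :> g'"
  then have "(\<lambda>h. h \<bullet> g') = (\<lambda>h. h \<bullet> g)"
    using assms unfolding gderiv_def by (rule has_derivative_unique)
  then show "g' = g"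
    by (metis vector_eq_ldot)
qed (fact assms)

text \<open>\<open>gradient\<close> is a definite description, so it says something only once a
  gradient exists. In a Euclidean space the derivative, being a linear functional, is the inner
  product with some vector.\<close>

lemma GDERIV_gradient:
  fixes f :: "'a::euclidean_space \<Rightarrow> real"
  assumes "f differentiable at x"
  shows "GDERIV f x :> gradient f x"
proof -
  obtain f' where f': "(f has_derivative f') (at x)"
    using assms unfolding differentiable_def by blast
  \<comment> \<open>The representing vector is the adjoint at 1, since
    \<open>h \<bullet> adjoint f' 1 = f' h * 1\<close>.\<close>
  have "f' = (\<lambda>h. h \<bullet> adjoint f' 1)"
    using adjoint_works[OF has_derivative_linear[OF f'], of _ 1] by auto
  then have "GDERIV f x :> adjoint f' 1"
    using f' unfolding gderiv_def by simp
  then show ?thesis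
    using gradient_eqI by metis
qed

lemma gradient_diff:
  fixes f g :: "'a::euclidean_space \<Rightarrow> real"
  assumes "f differentiable at x" "g differentiable at x"
  shows "gradient (\<lambda>y. f y - g y) x = gradient f x - gradient g x"
  by (intro gradient_eqI GDERIV_diff GDERIV_gradient assms)

lemma sym_pos_def_invertible:
  assumes "sym_pos_def A"
  shows "invertible A"
proof -
  \<comment> \<open>A nonzero kernel vector would give \<open>x \<bullet> (A *v x) = 0\<close>,
    against positivity.\<close>
  have "x = 0" if "A *v x = 0" for x
    using assms that unfolding sym_pos_def_def by force
  then show ?thesis
    unfolding invertible_left_inverse matrix_left_invertible_ker by blast
qed

lemma matrix_inv_mult_vector:
  fixes A :: "real^'n^'n"
  assumes "invertible A"
  shows "matrix_inv A *v (A *v x) = x"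
proof -
  have "A ** matrix_inv A = mat 1 \<and> matrix_inv A ** A = mat 1"
    using assms unfolding invertible_def matrix_inv_def by (rule someI_ex)
  then show ?thesis
    by (simp add: matrix_vector_mul_assoc)
qed

text \<open>The mean value inequality on the image of \<open>S\<close> under \<open>D\<close>, which
  is again convex. The field \<open>G\<close> is arbitrary; for a gradient field the Jacobian is the
  Hessian.\<close>

lemma preconditioned_linearization_bound:
  fixes G :: "real^'n \<Rightarrow> real^'n" and D :: "real^'n^'n"
  assumes "convex S" and D: "invertible D"
    and G: "\<And>v. v \<in> S \<Longrightarrow> G differentiable at v"
    and bound: "\<And>v. v \<in> S \<Longrightarrow>
      onorm ((*v) (matrix_inv D ** (- jacobian G (at v)) ** matrix_inv D - mat 1)) \<le> c"
    and "v \<in> S" "w \<in> S"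
  shows "norm (matrix_inv D *v (G v - G w) + D *v (v - w)) \<le> c * norm (D *v (v - w))"
proof -
  let ?E = "matrix_inv D"
  let ?g = "\<lambda>u. ?E *v G (?E *v u) + u"
  let ?A = "\<lambda>u. ?E ** (- jacobian G (at (?E *v u))) ** ?E - mat 1"
  have "norm (?g (D *v v) - ?g (D *v w)) \<le> c * norm (D *v v - D *v w)"
  \<comment> \<open>The derivative of \<open>?g\<close> is E J E + I, with E the inverse of
    \<open>D\<close> and J the Jacobian of \<open>G\<close>. This is the negative of the matrix
    \<open>?A u\<close>, and the sign leaves the operator norm unchanged.\<close>
  proof (rule differentiable_bound[where S = "(*v) D ` S" and f' = "\<lambda>u h. - (?A u *v h)"])
    show "convex ((*v) D ` S)"
      using \<open>convex S\<close> by (intro convex_linear_image) simp_all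
  next
    fix u assume "u \<in> (*v) D ` S"
    then have u: "?E *v u \<in> S"
      by (auto simp: matrix_inv_mult_vector[OF D])
    have "(G has_derivative (\<lambda>h. jacobian G (at (?E *v u)) *v h)) (at (?E *v u))"
      using G[OF u] by (simp add: jacobian_works)
    from has_derivative_compose[OF
        bounded_linear_imp_has_derivative[OF matrix_vector_mul_bounded_linear] this]
    have "((\<lambda>u. G (?E *v u)) has_derivative
        (\<lambda>h. jacobian G (at (?E *v u)) *v (?E *v h))) (at u)" .
    from has_derivative_add[OF bounded_linear.has_derivative[OF
        matrix_vector_mul_bounded_linear[of ?E] this] has_derivative_ident]
    have "(?g has_derivative
        (\<lambda>h. ?E *v (jacobian G (at (?E *v u)) *v (?E *v h)) + h)) (at u)" .
    moreover have "(\<lambda>h. ?E *v (jacobian G (at (?E *v u)) *v (?E *v h)) + h)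
        = (\<lambda>h. - (?A u *v h))"
    proof
      fix h
      have "(- X) *v y = - (X *v y)" for X :: "real^'n^'n" and y
        using matrix_vector_mult_diff_rdistrib[of 0 X y] by simp
      then show "?E *v (jacobian G (at (?E *v u)) *v (?E *v h)) + h = - (?A u *v h)"
        by (simp add: matrix_vector_mult_diff_rdistrib linear_neg
            flip: matrix_vector_mul_assoc)
    qed
    ultimately show "(?g has_derivative (\<lambda>h. - (?A u *v h))) (at u within (*v) D ` S)"
      by (simp add: has_derivative_at_withinI)
    show "onorm (\<lambda>h. - (?A u *v h)) \<le> c"
      unfolding onorm_neg using bound[OF u] by simp
  qed (use assms in auto)
  then show ?thesis
    by (simp add: matrix_inv_mult_vector[OF D] matrix_vector_mult_diff_distrib algebra_simps)
qed

theorem theoremC1: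
  fixes M :: "'s measure"
    and L :: "'s \<Rightarrow> real^('p::finite + 'm::finite) \<Rightarrow> real"
    and \<Upsilon> U :: "(real^('p + 'm)) set"
    and D2 D B :: "real^('p + 'm)^('p + 'm)"
    and \<upsilon>s :: "real^('p + 'm)"
    and \<upsilon>t \<upsilon>t\<theta> :: "'s \<Rightarrow> real^('p + 'm)"
    and \<delta> :: "real \<Rightarrow> real"
    and \<nu>0 \<omega> x r :: real
    and z0 :: "real \<Rightarrow> nat \<Rightarrow> real"
    and z :: "real \<Rightarrow> real^('p + 'm)^('p + 'm) \<Rightarrow> real"
  assumes "prob_space M"
    and U: "open U" "\<Upsilon> \<subseteq> U"
    and integrable_L: "\<And>\<upsilon>. \<upsilon> \<in> U \<Longrightarrow> integrable M (\<lambda>s. L s \<upsilon>)"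
    and smooth_L: "\<And>s. s \<in> space M \<Longrightarrow> L s differentiable_on U"
    and smooth_EL: "mean_fun M L differentiable_on U"
        "gradient (mean_fun M L) differentiable_on U"
    and argmax_s: "is_arg_max (mean_fun M L) (\<lambda>\<upsilon>. \<upsilon> \<in> \<Upsilon>) \<upsilon>s"
    and argmax_t: "\<And>s. s \<in> space M \<Longrightarrow> is_arg_max (L s) (\<lambda>\<upsilon>. \<upsilon> \<in> \<Upsilon>) (\<upsilon>t s)"
    and argmax_t\<theta>: "\<And>s. s \<in> space M \<Longrightarrow>
          is_arg_max (L s) (\<lambda>\<upsilon>. \<upsilon> \<in> \<Upsilon> \<and> target \<upsilon> = target \<upsilon>s) (\<upsilon>t\<theta> s)"
    and stationary_s: "gradient (mean_fun M L) \<upsilon>s = 0"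
    and stationary_t: "\<And>s. s \<in> space M \<Longrightarrow> gradient (L s) (\<upsilon>t s) = 0"
    and pos: "\<nu>0 > 0" "\<omega> > 0" "z0 x CARD('p + 'm) > 0" "z x B > 0" "x > 0" "r > 0"
    and D2: "sym_pos_def D2"
    and D: "sym_pos_def D" "D ** D = D2"
    and nbhd: "convex (local_set \<Upsilon> D \<upsilon>s r)" "\<upsilon>s \<in> interior (local_set \<Upsilon> D \<upsilon>s r)"
    and hessian_bound: "\<And>\<upsilon>. \<upsilon> \<in> local_set \<Upsilon> D \<upsilon>s r \<Longrightarrow>
          onorm ((*v) (matrix_inv D ** (- hessian (mean_fun M L) \<upsilon>) ** matrix_inv D - mat 1)) \<le> \<delta> r"
    and r_ge: "r \<ge> z x B"
  shows "\<forall>s \<in> good_event M L \<Upsilon> D2 D \<upsilon>s \<upsilon>t \<upsilon>t\<theta> r (z x B) (6 * \<nu>0 * \<omega> * z0 x CARD('p + 'm) * r).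
           norm (D *v (\<upsilon>t s - \<upsilon>s) - score L D \<upsilon>s s)
             \<le> approx_error \<delta> \<nu>0 \<omega> z0 CARD('p + 'm) r x"
proof
  fix s
  let ?S = "local_set \<Upsilon> D \<upsilon>s r"
  let ?G = "gradient (mean_fun M L)"
  let ?E = "matrix_inv D"
  let ?b = "6 * \<nu>0 * \<omega> * z0 x CARD('p + 'm) * r"
  assume s: "s \<in> good_event M L \<Upsilon> D2 D \<upsilon>s \<upsilon>t \<upsilon>t\<theta> r (z x B) ?b"
  then have sM: "s \<in> space M" and t: "\<upsilon>t s \<in> ?S"
    and sup: "(SUP \<upsilon> \<in> ?S. ereal (norm (gradient_gap M L D \<upsilon>s s \<upsilon>))) \<le> ereal ?b"
    unfolding good_event_def by auto
  have invD: "invertible D"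
    using D(1) by (rule sym_pos_def_invertible)
  have S_U: "?S \<subseteq> U"
    using U(2) unfolding local_set_def by blast
  have sS: "\<upsilon>s \<in> ?S"
    using nbhd(2) interior_subset by blast
  \<comment> \<open>Openness of \<open>U\<close> turns differentiability within the set into
    differentiability at the point, also for points on the boundary of
    \<open>\<Upsilon>\<close>.\<close>
  have diff: "f differentiable at \<upsilon>" if "f differentiable_on U" "\<upsilon> \<in> ?S"
    for \<upsilon> and f :: "real^('p + 'm) \<Rightarrow> 'b::real_normed_vector"
    using that S_U U(1) differentiable_on_eq_differentiable_at by blast
  have grad: "gradient (stoch_part M L s) \<upsilon> = gradient (L s) \<upsilon> - ?G \<upsilon>" if "\<upsilon> \<in> ?S" for \<upsilon>
  proof -
    have "stoch_part M L s = (\<lambda>\<upsilon>. L s \<upsilon> - mean_fun M L \<upsilon>)"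
      by (simp add: fun_eq_iff stoch_part_def)
    then show ?thesis
      using gradient_diff[OF diff[OF smooth_L[OF sM] that] diff[OF smooth_EL(1) that]] by simp
  qed
  \<comment> \<open>A bound on a supremum in \<open>ereal\<close> passes to each value with no
    boundedness to check.\<close>
  have gap: "norm (gradient_gap M L D \<upsilon>s s (\<upsilon>t s)) \<le> ?b"
    using sup t by (simp add: SUP_le_iff)
  have norm_t: "norm (D *v (\<upsilon>t s - \<upsilon>s)) \<le> r"
    using t unfolding local_set_def by simp
  \<comment> \<open>The sign follows because \<open>\<delta> r\<close> dominates an operator norm at
    \<open>\<upsilon>s\<close>; it is what allows the distance to be replaced by \<open>r\<close>
    below.\<close>
  have \<delta>_nonneg: "0 \<le> \<delta> r"
    using onorm_pos_le[OF matrix_vector_mul_bounded_linear] hessian_bound[OF sS]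
    by (rule order_trans)
  have "norm (?E *v (?G (\<upsilon>t s) - ?G \<upsilon>s) + D *v (\<upsilon>t s - \<upsilon>s)) \<le> \<delta> r * norm (D *v (\<upsilon>t s - \<upsilon>s))"
    using nbhd(1) invD diff[OF smooth_EL(2)] hessian_bound t sS
    unfolding hessian_def by (rule preconditioned_linearization_bound)
  also have "\<dots> \<le> \<delta> r * r"
    using norm_t \<delta>_nonneg by (rule mult_left_mono)
  finally have lin: "norm (?E *v (?G (\<upsilon>t s) - ?G \<upsilon>s) + D *v (\<upsilon>t s - \<upsilon>s)) \<le> \<delta> r * r" .
  \<comment> \<open>By the two stationarity conditions the gap equals
    \<open>- (?E *v ?G (\<upsilon>t s))\<close> minus the score, and \<open>?G \<upsilon>s\<close>
    vanishes. The terms in \<open>?G (\<upsilon>t s)\<close> therefore cancel in the sum.\<close>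
  have "D *v (\<upsilon>t s - \<upsilon>s) - score L D \<upsilon>s s
      = (?E *v (?G (\<upsilon>t s) - ?G \<upsilon>s) + D *v (\<upsilon>t s - \<upsilon>s)) + gradient_gap M L D \<upsilon>s s (\<upsilon>t s)"
    unfolding gradient_gap_def score_def grad[OF t] grad[OF sS] stationary_s stationary_t[OF sM]
    by (simp add: matrix_vector_mult_diff_distrib linear_neg)
  then have "norm (D *v (\<upsilon>t s - \<upsilon>s) - score L D \<upsilon>s s) \<le> \<delta> r * r + ?b"
    using norm_triangle_mono[OF lin gap] by (simp only:)
  then show "norm (D *v (\<upsilon>t s - \<upsilon>s) - score L D \<upsilon>s s)
      \<le> approx_error \<delta> \<nu>0 \<omega> z0 CARD('p + 'm) r x"
    by (simp add: approx_error_def distrib_right)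
qed

end
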